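(* Let $(E_1,\mathcal{E}_1)$ and $(E_2,\mathcal{E}_2)$ be measurable spaces, and let $(X_n)$ and $(Y_n)$ be sequences of random elements of $E_1$ and $E_2$ respectively, defined on one probability space $(\Omega,\mathcal{F},\mathbb{P})$. Let $\Omega_n\in\mathcal{F}$ be events such that, for every $n$, $X_n$ and $Y_n$ are conditionally independent given $\Omega_n$, and $\mathbb{P}(\Omega_n)\to 1$. Then condition AI-3 is satisfied.
   Context: $P_\xi$ denotes the distribution of a random element $\xi$; $(X_n,Y_n)$ is regarded as a random element of $(E_1\times E_2,\mathcal{E}_1\times\mathcal{E}_2)$. Conditional independence given the event $\Omega_n$ means: $\mathbb{P}\{X_n\in A,Y_n\in B\mid\Omega_n\}=\mathbb{P}\{X_n\in A\mid\Omega_n\}\,\mathbb{P}\{Y_n\in B\mid\Omega_n\}$ for all $A\in\mathcal{E}_1$, $B\in\mathcal{E}_2$ (whenever $\mathbb{P}(\Omega_n)>0$). AI-3: $\sup_{A\in\mathcal{E}_1,B\in\mathcal{E}_2}|P_{(X_n,Y_n)}(A\times B)-P_{X_n}(A)P_{Y_n}(B)|\to 0$ as $n\to+\infty$. *)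

theory Defs
  imports "HOL-Probability.Probability"
begin

context prob_space
begin

definition cond_indep_given ::
  "'b measure \<Rightarrow> 'c measure \<Rightarrow> ('a \<Rightarrow> 'b) \<Rightarrow> ('a \<Rightarrow> 'c) \<Rightarrow> 'a set \<Rightarrow> bool" where
  "cond_indep_given E1 E2 X Y W \<longleftrightarrow>
    (prob W > 0 \<longrightarrow>
      (\<forall>A\<in>sets E1. \<forall>B\<in>sets E2.
        \<P>(\<omega> in M. X \<omega> \<in> A \<and> Y \<omega> \<in> B \<bar> \<omega> \<in> W) =
        \<P>(\<omega> in M. X \<omega> \<in> A \<bar> \<omega> \<in> W) * \<P>(\<omega> in M. Y \<omega> \<in> B \<bar> \<omega> \<in> W)))"

text \<open>The supremum is taken in the reals: the family is nonempty and bounded by 1, so the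
  conditionally complete \<open>SUP\<close> is the genuine supremum.\<close>

definition AI3 ::
  "'b measure \<Rightarrow> 'c measure \<Rightarrow> (nat \<Rightarrow> 'a \<Rightarrow> 'b) \<Rightarrow> (nat \<Rightarrow> 'a \<Rightarrow> 'c) \<Rightarrow> bool" where
  "AI3 E1 E2 X Y \<longleftrightarrow>
    (\<lambda>n. SUP (A, B) \<in> sets E1 \<times> sets E2.
        \<bar>measure (distr M (E1 \<Otimes>\<^sub>M E2) (\<lambda>\<omega>. (X n \<omega>, Y n \<omega>))) (A \<times> B) -
         measure (distr M E1 (X n)) A * measure (distr M E2 (Y n)) B\<bar>) \<longlonglongrightarrow> 0"

end

end

theory Submission
  imports Defs
begin

text \<open>
  Conditioning on an event \<open>W\<close> of positive probability changes the probability of every event by at most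
  \<open>\<delta> = 1 - \<P>(W)\<close>, uniformly in the event.  Hence, when \<open>X\<close> and \<open>Y\<close> are conditionally independent
  given \<open>W\<close>, each of the three probabilities in
  \<open>\<P>(X \<in> A, Y \<in> B) - \<P>(X \<in> A) \<P>(Y \<in> B)\<close> can be replaced by its conditional version at a cost of
  \<open>\<delta>\<close>, after which the difference vanishes.  So the supremum over \<open>A\<close> and \<open>B\<close> lies between \<open>0\<close> and
  \<open>3 \<delta>\<close> (trivially so if \<open>\<P>(W) = 0\<close>), and \<open>\<delta>\<close> tends to \<open>0\<close> along the sequence of conditioning events.
\<close>

context prob_space
begin

lemma abs_cond_prob_diff_le:
  assumes S: "{\<omega> \<in> space M. P \<omega>} \<in> events" and W: "W \<in> events" and pos: "prob W > 0"
  shows "\<bar>\<P>(\<omega> in M. P \<omega> \<bar> \<omega> \<in> W) - \<P>(\<omega> in M. P \<omega>)\<bar> \<le> 1 - prob W"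
proof -
  let ?S = "{\<omega> \<in> space M. P \<omega>}"
  have WS: "{\<omega> \<in> space M. \<omega> \<in> W} = W" "{\<omega> \<in> space M. P \<omega> \<and> \<omega> \<in> W} = ?S \<inter> W"
    using sets.sets_into_space[OF W] by auto
  have cond: "\<P>(\<omega> in M. P \<omega> \<bar> \<omega> \<in> W) = prob (?S \<inter> W) / prob W"
    unfolding cond_prob_def WS ..
  have le1: "prob (?S \<inter> W) / prob W \<le> 1"
    using pos finite_measure_mono[OF _ W, of "?S \<inter> W"] by simp
  \<comment> \<open>Subtracting and adding \<open>\<P>(S \<inter> W)\<close> writes the difference as
    \<open>\<P>(S | W) (1 - \<P>(W)) - \<P>(S - W)\<close>, and both terms lie in \<open>[0, 1 - \<P>(W)]\<close>.\<close>
  have split: "prob (?S \<inter> W) / prob W - prob (?S \<inter> W) = prob (?S \<inter> W) / prob W * (1 - prob W)"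
    using pos by (simp add: field_simps)
  have "prob (?S \<inter> W) / prob W - prob (?S \<inter> W) \<le> 1 - prob W"
    unfolding split using mult_right_mono[OF le1, of "1 - prob W"] by simp
  moreover have "0 \<le> prob (?S \<inter> W) / prob W - prob (?S \<inter> W)"
    unfolding split by simp
  moreover have "prob ?S = prob (?S \<inter> W) + prob (?S - W)"
    using finite_measure_Diff'[OF S W] by simp
  moreover have "prob (?S - W) \<le> 1 - prob W"
    using finite_measure_mono[of "?S - W" "space M - W"] W prob_compl[OF W] by auto
  moreover have "0 \<le> prob (?S - W)" by simp
  ultimately show ?thesis unfolding cond by linarith
qed

lemma abs_prob_conj_diff_le_of_cond_indep:
  assumes X: "X \<in> measurable M E1" and Y: "Y \<in> measurable M E2" and W: "W \<in> events"
    and ci: "cond_indep_given E1 E2 X Y W" and A: "A \<in> sets E1" and B: "B \<in> sets E2"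
  shows "\<bar>\<P>(\<omega> in M. X \<omega> \<in> A \<and> Y \<omega> \<in> B) - \<P>(\<omega> in M. X \<omega> \<in> A) * \<P>(\<omega> in M. Y \<omega> \<in> B)\<bar>
    \<le> 3 * (1 - prob W)"
proof (cases "prob W > 0")
  case True
  note [measurable] = X Y A B
  define a where "a = \<P>(\<omega> in M. X \<omega> \<in> A)"
  define b where "b = \<P>(\<omega> in M. Y \<omega> \<in> B)"
  define j where "j = \<P>(\<omega> in M. X \<omega> \<in> A \<and> Y \<omega> \<in> B)"
  define a' where "a' = \<P>(\<omega> in M. X \<omega> \<in> A \<bar> \<omega> \<in> W)"
  define b' where "b' = \<P>(\<omega> in M. Y \<omega> \<in> B \<bar> \<omega> \<in> W)"
  let ?d = "1 - prob W"
  have "\<P>(\<omega> in M. X \<omega> \<in> A \<and> Y \<omega> \<in> B \<bar> \<omega> \<in> W) = a' * b'"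
    using ci True A B unfolding cond_indep_given_def a'_def b'_def by blast
  then have joint: "\<bar>a' * b' - j\<bar> \<le> ?d"
    using abs_cond_prob_diff_le[OF _ W True, of "\<lambda>\<omega>. X \<omega> \<in> A \<and> Y \<omega> \<in> B"]
    by (simp add: j_def)
  have da: "\<bar>a' - a\<bar> \<le> ?d" and db: "\<bar>b' - b\<bar> \<le> ?d"
    unfolding a_def a'_def b_def b'_def by (intro abs_cond_prob_diff_le W True; measurable)+
  have a: "\<bar>a\<bar> \<le> 1" unfolding a_def by simp
  have "{\<omega> \<in> space M. \<omega> \<in> W} = W"
    using sets.sets_into_space[OF W] by auto
  moreover have "prob {\<omega> \<in> space M. Y \<omega> \<in> B \<and> \<omega> \<in> W} \<le> prob W"
    using W by (intro finite_measure_mono) auto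
  ultimately have b': "\<bar>b'\<bar> \<le> 1"
    unfolding b'_def cond_prob_def using True by simp
  have "a' * b' - a * b = (a' - a) * b' + a * (b' - b)"
    by (simp add: algebra_simps)
  moreover have "\<bar>(a' - a) * b'\<bar> \<le> ?d * 1"
    unfolding abs_mult using da b' by (intro mult_mono) auto
  moreover have "\<bar>a * (b' - b)\<bar> \<le> 1 * ?d"
    unfolding abs_mult using a db by (intro mult_mono) auto
  moreover have "\<bar>(a' - a) * b' + a * (b' - b)\<bar> \<le> \<bar>(a' - a) * b'\<bar> + \<bar>a * (b' - b)\<bar>"
    by (rule abs_triangle_ineq)
  ultimately have "\<bar>a' * b' - a * b\<bar> \<le> 2 * ?d"
    by simp
  then show ?thesis
    using joint unfolding a_def[symmetric] b_def[symmetric] j_def[symmetric] by simp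
next
  case False
  \<comment> \<open>Conditional independence says nothing when \<open>\<P>(W) = 0\<close>, but then the bound is \<open>3\<close>, whereas
    the difference of two numbers in \<open>[0, 1]\<close> is at most \<open>1\<close>.\<close>
  then have "prob W = 0"
    using measure_nonneg[of M W] by linarith
  moreover have "\<P>(\<omega> in M. X \<omega> \<in> A) * \<P>(\<omega> in M. Y \<omega> \<in> B) \<le> 1" "\<P>(\<omega> in M. X \<omega> \<in> A \<and> Y \<omega> \<in> B) \<le> 1"
    by (auto intro: mult_le_one)
  moreover have "0 \<le> \<P>(\<omega> in M. X \<omega> \<in> A) * \<P>(\<omega> in M. Y \<omega> \<in> B)" "0 \<le> \<P>(\<omega> in M. X \<omega> \<in> A \<and> Y \<omega> \<in> B)"
    by auto
  ultimately show ?thesis unfolding right_diff_distrib by linarith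
qed

lemma abs_distr_Times_diff_le_of_cond_indep:
  assumes X: "X \<in> measurable M E1" and Y: "Y \<in> measurable M E2" and W: "W \<in> events"
    and ci: "cond_indep_given E1 E2 X Y W" and A: "A \<in> sets E1" and B: "B \<in> sets E2"
  shows "\<bar>measure (distr M (E1 \<Otimes>\<^sub>M E2) (\<lambda>\<omega>. (X \<omega>, Y \<omega>))) (A \<times> B)
      - measure (distr M E1 X) A * measure (distr M E2 Y) B\<bar> \<le> 3 * (1 - prob W)"
proof -
  have "measure (distr M (E1 \<Otimes>\<^sub>M E2) (\<lambda>\<omega>. (X \<omega>, Y \<omega>))) (A \<times> B) = \<P>(\<omega> in M. X \<omega> \<in> A \<and> Y \<omega> \<in> B)"
    using X Y A B by (subst measure_distr) (auto intro!: arg_cong[where f = prob])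
  moreover have "measure (distr M E1 X) A = \<P>(\<omega> in M. X \<omega> \<in> A)"
    using X A by (subst measure_distr) (auto intro!: arg_cong[where f = prob])
  moreover have "measure (distr M E2 Y) B = \<P>(\<omega> in M. Y \<omega> \<in> B)"
    using Y B by (subst measure_distr) (auto intro!: arg_cong[where f = prob])
  ultimately show ?thesis
    using abs_prob_conj_diff_le_of_cond_indep[OF assms] by simp
qed

end

theorem proposition4:
  fixes M :: "'a measure" and E1 :: "'b measure" and E2 :: "'c measure"
    and X :: "nat \<Rightarrow> 'a \<Rightarrow> 'b" and Y :: "nat \<Rightarrow> 'a \<Rightarrow> 'c" and W :: "nat \<Rightarrow> 'a set"
  assumes "prob_space M"
    and "\<And>n. X n \<in> measurable M E1"
    and "\<And>n. Y n \<in> measurable M E2"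
    and "\<And>n. W n \<in> sets M"
    and "\<And>n. prob_space.cond_indep_given M E1 E2 (X n) (Y n) (W n)"
    and "(\<lambda>n. measure M (W n)) \<longlonglongrightarrow> 1"
  shows "prob_space.AI3 M E1 E2 X Y"
proof -
  interpret prob_space M by fact
  define f where "f n = (\<lambda>(A, B).
      \<bar>measure (distr M (E1 \<Otimes>\<^sub>M E2) (\<lambda>\<omega>. (X n \<omega>, Y n \<omega>))) (A \<times> B) -
         measure (distr M E1 (X n)) A * measure (distr M E2 (Y n)) B\<bar>)" for n
  let ?I = "sets E1 \<times> sets E2"
  have bound: "f n p \<le> 3 * (1 - prob (W n))" if "p \<in> ?I" for n p
    using that abs_distr_Times_diff_le_of_cond_indep[OF assms(2-5)] by (auto simp: f_def)
  have mem: "({}, {}) \<in> ?I" by simp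
  have upper: "(SUP p\<in>?I. f n p) \<le> 3 * (1 - prob (W n))" for n
    using mem by (intro cSUP_least bound) auto
  have lower: "0 \<le> (SUP p\<in>?I. f n p)" for n
  proof -
    have "f n ({}, {}) \<le> (SUP p\<in>?I. f n p)"
      using bound by (intro cSUP_upper mem bdd_aboveI2)
    then show ?thesis by (simp add: f_def)
  qed
  have "(\<lambda>n. 3 * (1 - prob (W n))) \<longlonglongrightarrow> 3 * (1 - 1)"
    by (intro tendsto_mult tendsto_diff tendsto_const assms(6))
  then have "(\<lambda>n. 3 * (1 - prob (W n))) \<longlonglongrightarrow> 0" by simp
  then have "(\<lambda>n. SUP p\<in>?I. f n p) \<longlonglongrightarrow> 0"
    by (rule tendsto_sandwich[OF _ _ tendsto_const, rotated 2])
      (intro always_eventually allI lower upper)+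
  then show ?thesis
    unfolding AI3_def f_def .
qed

end
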